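(* Let $\mathcal{B}$ be an infinite complete ccc Boolean algebra of cardinality at most $\mathfrak{c}$. Then the following are equivalent: (i) every filter $\mathcal{F}$ on $\mathcal{B}$ that has a base of cardinality smaller than $\mathfrak{c}$ can be extended to a coherent selective ultrafilter on $\mathcal{B}$; (ii) $\mathfrak{c} = \operatorname{cov}(\mathcal{M})$.
   Context: $\mathfrak{c} = 2^{\aleph_0}$, and $\operatorname{cov}(\mathcal{M})$ is the least cardinality of a family of meager subsets of the Baire space $\omega^\omega$ whose union is the whole of $\omega^\omega$. Filters are proper. A base of a filter $\mathcal{F}$ on $\mathcal{B}$ is a subset of $\mathcal{F}$ such that every element of $\mathcal{F}$ is above some element of the subset. A partition of a Boolean algebra $\mathcal{B}$ is a maximal antichain, i.e. a maximal set of pairwise disjoint nonzero elements. In an infinite ccc algebra every infinite partition is countable, and is written $P = \{p_n : n \in \omega\}$ (enumerated without repetition). A selective ultrafilter on $\omega$ is an ultrafilter $\mathcal{V}$ on $\omega$ (principal ultrafilters allowed) such that for every partition $\{Q_n : n\in\omega\}$ of $\omega$ either $Q_n \in \mathcal{V}$ for some $n$, or there is $X \in \mathcal{V}$ such that $X \cap Q_n$ has at most one element for all $n$. An ultrafilter $\mathcal{U}$ on a complete ccc Boolean algebra $\mathcal{B}$ is a coherent selective ultrafilter if for every infinite partition $P = \{p_n : n\in\omega\}$ of $\mathcal{B}$, the family $\{A \subseteq \omega : \bigvee\{p_n : n \in A\} \in \mathcal{U}\}$ is a selective ultrafilter on $\omega$. *)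

theory Defs
  imports "HOL-Analysis.Function_Topology" "HOL-Library.Disjoint_Sets"
begin

unbundle cardinal_syntax

(* A complete Boolean algebra is a type of sort {boolean_algebra, complete_lattice}.  The library
   class complete_boolean_algebra is NOT the right one: it extends complete_distrib_lattice, which
   demands complete distributivity, so that it only has atomic instances. *)

definition continuum :: "(nat \<Rightarrow> bool) rel"
  where "continuum = ctwo ^c natLeq"

definition nowhere_dense :: "'a::topological_space set \<Rightarrow> bool"
  where "nowhere_dense S \<longleftrightarrow> interior (closure S) = {}"

definition meager :: "'a::topological_space set \<Rightarrow> bool"
  where "meager S \<longleftrightarrow> (\<exists>N :: nat \<Rightarrow> 'a set. (\<forall>n. nowhere_dense (N n)) \<and> S = (\<Union>n. N n))"

(* The topology of the type nat \<Rightarrow> nat is the product of the discrete topologies: Baire space. *)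
definition meager_covers :: "(nat \<Rightarrow> nat) set set set"
  where "meager_covers = {\<C>. (\<forall>S\<in>\<C>. meager S) \<and> \<Union>\<C> = UNIV}"

definition cov_M :: "(nat \<Rightarrow> nat) set rel"
  where "cov_M = (SOME \<kappa>. \<exists>\<C>\<in>meager_covers. \<kappa> = |\<C>| \<and> (\<forall>\<D>\<in>meager_covers. |\<C>| \<le>o |\<D>| ))"

definition antichain :: "'a::boolean_algebra set \<Rightarrow> bool"
  where "antichain P \<longleftrightarrow> bot \<notin> P \<and> pairwise (\<lambda>x y. inf x y = bot) P"

definition ba_partition :: "'a::boolean_algebra set \<Rightarrow> bool"
  where "ba_partition P \<longleftrightarrow> antichain P \<and> (\<forall>Q. antichain Q \<and> P \<subseteq> Q \<longrightarrow> Q = P)"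

definition ccc :: "'a::boolean_algebra itself \<Rightarrow> bool"
  where "ccc _ \<longleftrightarrow> (\<forall>P :: 'a set. antichain P \<longrightarrow> countable P)"

definition ba_filter :: "'a::boolean_algebra set \<Rightarrow> bool"
  where "ba_filter F \<longleftrightarrow> top \<in> F \<and> bot \<notin> F \<and>
    (\<forall>x\<in>F. \<forall>y\<in>F. inf x y \<in> F) \<and> (\<forall>x\<in>F. \<forall>y. x \<le> y \<longrightarrow> y \<in> F)"

definition filter_base :: "'a::boolean_algebra set \<Rightarrow> 'a set \<Rightarrow> bool"
  where "filter_base G F \<longleftrightarrow> G \<subseteq> F \<and> (\<forall>x\<in>F. \<exists>y\<in>G. y \<le> x)"

definition ba_ultrafilter :: "'a::boolean_algebra set \<Rightarrow> bool"
  where "ba_ultrafilter U \<longleftrightarrow> ba_filter U \<and> (\<forall>F. ba_filter F \<and> U \<subseteq> F \<longrightarrow> F = U)"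

(* An ultrafilter on \<omega> is an ultrafilter on the Boolean algebra nat set.  Finite partitions are
   included; they impose nothing, since an ultrafilter contains a block of each. *)
definition selective_ultrafilter :: "nat set set \<Rightarrow> bool"
  where "selective_ultrafilter V \<longleftrightarrow> ba_ultrafilter V \<and>
    (\<forall>\<Q>. partition_on UNIV \<Q> \<longrightarrow>
       (\<exists>Q\<in>\<Q>. Q \<in> V) \<or> (\<exists>X\<in>V. \<forall>Q\<in>\<Q>. \<exists>\<^sub>\<le>\<^sub>1 n. n \<in> X \<inter> Q))"

(* Intended for ccc algebras, where the infinite partitions are exactly the sets range p with
   p injective on nat. *)
definition coherent_selective_ultrafilter :: "'a::{boolean_algebra, complete_lattice} set \<Rightarrow> bool"
  where "coherent_selective_ultrafilter U \<longleftrightarrow> ba_ultrafilter U \<and>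
    (\<forall>p :: nat \<Rightarrow> 'a. inj p \<and> ba_partition (range p) \<longrightarrow>
       selective_ultrafilter {A. Sup (p ` A) \<in> U})"

lemma meager_covers_nonempty: "range (\<lambda>x. {x}) \<in> meager_covers"
proof -
  have "interior {x} = {}" for x :: "nat \<Rightarrow> nat"
  proof (rule ccontr)
    assume "interior {x} \<noteq> {}"
    then have "open {x}"
      by (metis interior_subset open_interior subset_singletonD)
    then obtain X where X: "x \<in> (\<Pi>\<^sub>E i\<in>UNIV. X i)" "finite {i. X i \<noteq> UNIV}"
      "(\<Pi>\<^sub>E i\<in>UNIV. X i) \<subseteq> {x}"
      using product_topology_open_contains_basis[of "\<lambda>_. euclidean" UNIV "{x}" x]
      by (auto simp: open_fun_def)
    obtain i where i: "X i = UNIV"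
      using X(2) ex_new_if_finite[of "{i. X i \<noteq> UNIV}"] infinite_UNIV_nat by auto
    have "x(i := Suc (x i)) \<in> (\<Pi>\<^sub>E i\<in>UNIV. X i)"
      using X(1) i by (auto simp: PiE_iff)
    then have "x(i := Suc (x i)) = x"
      using X(3) by blast
    then show False
      by (metis fun_upd_same n_not_Suc_n)
  qed
  moreover have "closed {x}" for x :: "nat \<Rightarrow> nat"
  proof -
    have "closed (\<Inter>i. (\<lambda>y :: nat \<Rightarrow> nat. y i) -` {x i})"
      by (intro closed_INT ballI closed_vimage continuous_on_product_coordinates) auto
    moreover have "(\<Inter>i. (\<lambda>y. y i) -` {x i}) = {x}"
      by auto
    ultimately show ?thesis
      by simp
  qed
  ultimately have "meager {x}" for x :: "nat \<Rightarrow> nat"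
    unfolding meager_def nowhere_dense_def
    by (intro exI[of _ "\<lambda>_. {x}"]) (simp add: closure_closed)
  then show ?thesis
    by (auto simp: meager_covers_def)
qed

lemma cov_M_least:
  obtains \<C> where "\<C> \<in> meager_covers" "cov_M = |\<C>|" "\<And>\<D>. \<D> \<in> meager_covers \<Longrightarrow> cov_M \<le>o |\<D>|"
proof -
  have "card_of ` meager_covers \<noteq> {}" "\<forall>r \<in> card_of ` meager_covers. Card_order r"
    using meager_covers_nonempty by (auto simp: card_of_Card_order)
  then have "\<exists>r \<in> card_of ` meager_covers. \<forall>r' \<in> card_of ` meager_covers. r \<le>o r'"
    by (rule exists_minim_Card_order)
  then have "\<exists>\<kappa>. \<exists>\<C>\<in>meager_covers. \<kappa> = |\<C>| \<and> (\<forall>\<D>\<in>meager_covers. |\<C>| \<le>o |\<D>| )"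
    by auto
  from someI_ex[OF this] obtain \<C> where "\<C> \<in> meager_covers" "cov_M = |\<C>|"
    "\<forall>\<D>\<in>meager_covers. |\<C>| \<le>o |\<D>|"
    unfolding cov_M_def[symmetric] by blast
  then show ?thesis
    by (intro that) auto
qed

lemma continuum_ordIso: "continuum =o |UNIV :: nat set set|"
proof -
  have "bij_betw Collect (UNIV :: (nat \<Rightarrow> bool) set) UNIV"
    by (rule bij_betw_byWitness[where f' = "\<lambda>A x. x \<in> A"]) auto
  moreover have "continuum = |UNIV :: (nat \<Rightarrow> bool) set|"
    by (simp add: continuum_def cexp_def ctwo_def Field_natLeq Field_card_of Func_def)
  ultimately show ?thesis
    using card_of_ordIsoI by metis
qed

lemma ba_ultrafilter_iff: "ba_ultrafilter U \<longleftrightarrow> ba_filter U \<and> (\<forall>x. x \<in> U \<or> - x \<in> U)"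
proof
  assume U: "ba_ultrafilter U"
  then have F: "ba_filter U"
    by (simp add: ba_ultrafilter_def)
  have "- x \<in> U" if "x \<notin> U" for x
  proof (rule ccontr)
    assume nx: "- x \<notin> U"
    define G where "G = {z. \<exists>u\<in>U. inf u x \<le> z}"
    have "bot \<notin> G"
    proof
      assume "bot \<in> G"
      then obtain u where "u \<in> U" "inf u x = bot"
        by (auto simp: G_def bot_unique)
      then show False
        using F nx by (auto simp: ba_filter_def inf_shunt)
    qed
    moreover have "inf y z \<in> G" if "y \<in> G" "z \<in> G" for y z
    proof -
      from that obtain u v where uv: "u \<in> U" "v \<in> U" "inf u x \<le> y" "inf v x \<le> z"
        unfolding G_def by blast
      have "inf (inf u v) x \<le> inf y z"
        by (intro inf_greatest order.trans[OF _ uv(3)] order.trans[OF _ uv(4)] inf_mono) auto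
      moreover have "inf u v \<in> U"
        using F uv by (auto simp: ba_filter_def)
      ultimately show ?thesis
        by (auto simp: G_def)
    qed
    moreover have "top \<in> G"
      using F by (auto simp: G_def ba_filter_def)
    moreover have "z \<in> G" if "y \<in> G" "y \<le> z" for y z
      using that by (auto simp: G_def intro: order.trans)
    ultimately have "ba_filter G"
      by (simp add: ba_filter_def)
    moreover have "U \<subseteq> G"
      by (auto simp: G_def intro: le_infI1)
    ultimately have "G = U"
      using U by (simp add: ba_ultrafilter_def)
    moreover have "x \<in> G"
      using F by (auto simp: G_def ba_filter_def intro!: bexI[of _ top])
    ultimately show False
      using that by simp
  qed
  with F show "ba_filter U \<and> (\<forall>x. x \<in> U \<or> - x \<in> U)"
    by blast
next
  assume U: "ba_filter U \<and> (\<forall>x. x \<in> U \<or> - x \<in> U)"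
  have "x \<in> U" if "ba_filter F" "U \<subseteq> F" "x \<in> F" for F x
  proof (rule ccontr)
    assume "x \<notin> U"
    with U that(2) have "- x \<in> F"
      by blast
    with that have "inf x (- x) \<in> F"
      unfolding ba_filter_def by blast
    then show False
      using that by (simp add: ba_filter_def)
  qed
  then show "ba_ultrafilter U"
    using U by (auto simp: ba_ultrafilter_def)
qed

lemma infinite_partition_enumerable:
  fixes P :: "'a::boolean_algebra set"
  assumes "ccc TYPE('a)" "ba_partition P" "infinite P"
  obtains p :: "nat \<Rightarrow> 'a" where "inj p" "range p = P"
proof -
  have "countable P"
    using assms by (simp add: ccc_def ba_partition_def)
  then show ?thesis
    using that bij_betw_from_nat_into[OF _ assms(3)] by (auto simp: bij_betw_def)
qed

end

theory Submission
  imports Defs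
begin

text \<open>
  As the algebra has at most $\mathfrak{c}$ elements, there are at most $\mathfrak{c}$ many tasks that a
  coherent selective ultrafilter has to fulfil: for
  each infinite partition $P = \{p_n\}$ of the algebra and each partition of $\<omega>$ into the fibres of
  a function $q$, it must contain some $\bigvee\{p_n : n \in X\}$ such that $q$ is constant or injective
  on $X$.

  Suppose $\mathfrak{c} = \operatorname{cov}(\mathcal{M})$.  The tasks are handled one after the other in
  a recursion of length $\mathfrak{c}$ (\<open>fip_transfinite\<close>), which maintains a family of size less than
  $\mathfrak{c}$ with the finite intersection property.  A task is fulfilled by adding a single element:
  either $X$ can be a fibre of $q$, or a sufficiently generic selector of the fibres is compatible with
  the family, where genericity amounts to avoiding fewer than $\operatorname{cov}(\mathcal{M})$ nowhere
  dense sets (\<open>fip_add_selector\<close>).  Every ultrafilter that contains the resulting family is coherent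
  selective.

  Conversely, suppose $\operatorname{cov}(\mathcal{M}) < \mathfrak{c}$.  It suffices to find fewer than
  $\mathfrak{c}$ subsets of $\<omega>$ with the finite intersection property that no selective ultrafilter on
  $\<omega>$ contains, because such a family can be transferred to the algebra along any infinite partition.
  From a small cover of Baire space by meager sets, \<open>base_without_selective_extension\<close> constructs such a
  family directly: a selective ultrafilter containing it would select a sequence of instructions for
  building a point of Baire space that lies outside all the given meager sets.
\<close>

section \<open>Sets of size less than the continuum\<close>

lemma infinite_nat_sets: "infinite (UNIV :: nat set set)"
  by (simp add: Finite_Set.finite_set)

lemma less_continuum_iff: "|A| <o continuum \<longleftrightarrow> |A| <o |UNIV :: nat set set|"
  using continuum_ordIso by (meson ordLess_ordIso_trans ordIso_symmetric)

lemma le_continuum_iff: "|A| \<le>o continuum \<longleftrightarrow> (\<exists>f :: 'a \<Rightarrow> nat set. inj_on f A)"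
proof -
  have "|A| \<le>o continuum \<longleftrightarrow> |A| \<le>o |UNIV :: nat set set|"
    using continuum_ordIso by (meson ordLeq_ordIso_trans ordIso_symmetric)
  then show ?thesis
    using card_of_ordLeq[of A "UNIV :: nat set set"] by auto
qed

lemma Un_less_continuum:
  assumes "|A| <o continuum" "|B| <o continuum"
  shows "|A \<union> B| <o continuum"
  using card_of_Un_ordLess_infinite[OF infinite_nat_sets] assms by (auto simp: less_continuum_iff)

lemma image_less_continuum:
  assumes "|A| <o continuum"
  shows "|f ` A| <o continuum"
  using card_of_image assms by (rule ordLeq_ordLess_trans)

lemma countable_less_continuum:
  assumes "countable A"
  shows "|A| <o continuum"
proof -
  have "|A| \<le>o |UNIV :: nat set|"
    using assms card_of_ordLeq[of A "UNIV :: nat set"] by (auto simp: countable_def)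
  also have "|UNIV :: nat set| <o |UNIV :: nat set set|"
    using card_of_Pow[of "UNIV :: nat set"] by simp
  finally (ordLeq_ordLess_trans) show ?thesis
    by (simp add: less_continuum_iff)
qed

text \<open>The finite subsets of $H$ are exhausted by countably many levels, the $n$-th consisting of the sets
  with an enumeration of length $n$; for infinite $H$ no level exceeds $H$ in size.\<close>

lemma Fpow_less_continuum:
  assumes "|H| <o continuum"
  shows "|Fpow H| <o continuum"
proof (cases "finite H")
  case True
  then show ?thesis
    by (intro countable_less_continuum countable_Fpow countable_finite)
next
  case False
  define B where "B = rec_nat {{}} (\<lambda>_ C. (\<lambda>(x, S). insert x S) ` (H \<times> C))"
  have B_simps: "B 0 = {{}}" "B (Suc n) = (\<lambda>(x, S). insert x S) ` (H \<times> B n)" for n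
    by (simp_all add: B_def)
  have "|B n| \<le>o |H|" for n
  proof (induction n)
    case 0
    have "H \<noteq> {}"
      using False by auto
    then show ?case
      by (simp add: B_simps card_of_singl_ordLeq)
  next
    case (Suc n)
    have "|H \<times> B n| \<le>o |H|"
      using False Suc by (intro card_of_Sigma_ordLeq_infinite) (auto intro: card_of_mono1)
    then show ?case
      unfolding B_simps by (rule ordLeq_transitive[OF card_of_image])
  qed
  then have "|\<Union>n. B n| \<le>o |H|"
    using False by (intro card_of_UNION_ordLeq_infinite) (auto simp: infinite_iff_card_of_nat)
  moreover have "S \<in> (\<Union>n. B n)" if "finite S" "S \<subseteq> H" for S
    using that
  proof (induction S)
    case empty
    then show ?case
      using B_simps(1) by blast
  next
    case (insert x S)
    then obtain n where "S \<in> B n"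
      by auto
    then have "insert x S \<in> B (Suc n)"
      using insert.prems by (auto simp: B_simps)
    then show ?case
      by blast
  qed
  then have "Fpow H \<subseteq> (\<Union>n. B n)"
    by (auto simp: Fpow_def)
  ultimately show ?thesis
    using assms card_of_mono1 ordLeq_ordLess_trans by metis
qed

lemma cov_M_le_continuum:
  shows "Card_order cov_M" "cov_M \<le>o continuum"
proof -
  obtain \<C> where C: "\<C> \<in> meager_covers" "cov_M = |\<C>|" "\<And>\<D>. \<D> \<in> meager_covers \<Longrightarrow> cov_M \<le>o |\<D>|"
    using cov_M_least by blast
  show "Card_order cov_M"
    unfolding C(2) by (rule card_of_Card_order)
  have "inj (\<lambda>f. prod_encode ` {(n, f n) | n. True} :: nat set)"
  proof (rule injI)
    fix f g :: "nat \<Rightarrow> nat"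
    assume "prod_encode ` {(n, f n) | n. True} = prod_encode ` {(n, g n) | n. True}"
    then have "{(n, f n) | n. True} = {(n, g n) | n. True}"
      by (simp add: inj_image_eq_iff inj_prod_encode)
    then show "f = g"
      by blast
  qed
  then have "|UNIV :: (nat \<Rightarrow> nat) set| \<le>o continuum"
    unfolding le_continuum_iff by blast
  then have "|range (\<lambda>x :: nat \<Rightarrow> nat. {x})| \<le>o continuum"
    by (rule ordLeq_transitive[OF card_of_image])
  then show "cov_M \<le>o continuum"
    using C(3)[OF meager_covers_nonempty] ordLeq_transitive by blast
qed

text \<open>This bounds the number of tasks that the recursion below has to deal with, a task being an
  enumerated partition of the algebra together with a partition of $\<omega>$.  The latter is given by a
  function, as its partition into fibres; an arbitrary set of sets of naturals would be too large a
  parameter.\<close>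

lemma sequences_le_continuum:
  assumes "|UNIV :: 'a set| \<le>o continuum"
  shows "|UNIV :: ((nat \<Rightarrow> 'a) \<times> (nat \<Rightarrow> nat)) set| \<le>o continuum"
proof -
  obtain e :: "'a \<Rightarrow> nat set" where e: "inj e"
    using assms by (auto simp: le_continuum_iff)
  \<comment> \<open>The triples with middle entry \<open>0\<close> record \<open>q\<close>, the others record \<open>p\<close>.\<close>
  define d :: "(nat \<Rightarrow> 'a) \<times> (nat \<Rightarrow> nat) \<Rightarrow> nat set"
    where "d = (\<lambda>(p, q). to_nat ` ({(n, 0, q n) | n. True} \<union> {(n, Suc k, 0) | n k. k \<in> e (p n)}))"
  have "inj d"
  proof (rule injI, clarify)
    fix p q p' q'
    assume "d (p, q) = d (p', q')"
    then have eq: "{(n, 0, q n) | n. True} \<union> {(n, Suc k, 0) | n k. k \<in> e (p n)}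
        = {(n, 0, q' n) | n. True} \<union> {(n, Suc k, 0) | n k. k \<in> e (p' n)}"
      unfolding d_def by (simp add: inj_image_eq_iff)
    have "q n = q' n" for n
      using eq[THEN equalityD1, THEN subsetD, of "(n, 0, q n)"] by auto
    moreover have "k \<in> e (p n) \<longleftrightarrow> k \<in> e (p' n)" for n k
      using arg_cong[OF eq, of "\<lambda>X. (n, Suc k, 0) \<in> X"] by auto
    then have "e (p n) = e (p' n)" for n
      by blast
    then have "p n = p' n" for n
      using e by (simp add: inj_eq)
    ultimately show "p = p' \<and> q = q'"
      by auto
  qed
  then show ?thesis
    unfolding le_continuum_iff by blast
qed

section \<open>Families with the finite intersection property\<close>

definition fip :: "'a::{boolean_algebra, complete_lattice} set \<Rightarrow> bool"
  where "fip H \<longleftrightarrow> (\<forall>S. finite S \<and> S \<subseteq> H \<longrightarrow> Inf S \<noteq> bot)"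

lemma fip_mono: "fip H \<Longrightarrow> K \<subseteq> H \<Longrightarrow> fip K"
  by (auto simp: fip_def)

text \<open>Distributivity over infinite joins, in the form used throughout: being disjoint from \<open>x\<close> means being
  below \<open>- x\<close>.\<close>

lemma inf_Sup_eq_bot_iff:
  fixes x :: "'a::{boolean_algebra, complete_lattice}"
  shows "inf (Sup A) x = bot \<longleftrightarrow> (\<forall>a\<in>A. inf a x = bot)"
  by (simp add: inf_shunt Sup_le_iff)

lemma fip_insert_iff:
  "fip (insert x H) \<longleftrightarrow> (\<forall>S. finite S \<and> S \<subseteq> H \<longrightarrow> inf x (Inf S) \<noteq> bot)"
proof
  assume L: "fip (insert x H)"
  show "\<forall>S. finite S \<and> S \<subseteq> H \<longrightarrow> inf x (Inf S) \<noteq> bot"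
  proof (intro allI impI)
    fix S assume "finite S \<and> S \<subseteq> H"
    then have "Inf (insert x S) \<noteq> bot"
      using L unfolding fip_def by blast
    then show "inf x (Inf S) \<noteq> bot"
      by simp
  qed
next
  assume R: "\<forall>S. finite S \<and> S \<subseteq> H \<longrightarrow> inf x (Inf S) \<noteq> bot"
  show "fip (insert x H)"
    unfolding fip_def
  proof (intro allI impI)
    fix S assume S: "finite S \<and> S \<subseteq> insert x H"
    then have "inf x (Inf (S - {x})) \<noteq> bot"
      using R by (metis Diff_subset_conv finite_Diff insert_is_Un)
    moreover have "inf x (Inf (S - {x})) \<le> Inf S"
      by (rule Inf_greatest) (metis Diff_iff Inf_lower inf_le1 le_infI2 singletonD)
    ultimately show "Inf S \<noteq> bot"
      by (metis bot_unique)
  qed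
qed

lemma fip_extend:
  assumes "fip H"
  shows "fip (insert x H) \<or> fip (insert (- x) H)"
proof (rule ccontr)
  assume "\<not> ?thesis"
  then obtain S T where ST: "finite S" "S \<subseteq> H" "inf x (Inf S) = bot"
    "finite T" "T \<subseteq> H" "inf (- x) (Inf T) = bot"
    by (auto simp: fip_insert_iff)
  have "Inf (S \<union> T) \<le> - x" "Inf (S \<union> T) \<le> x"
    using ST(3,6) unfolding inf.commute[of x] inf.commute[of "- x"] inf_shunt
    by (auto simp: Inf_union_distrib intro: le_infI1 le_infI2)
  then have "Inf (S \<union> T) \<le> bot"
    by (metis compl_inf_bot inf_greatest)
  then show False
    using assms ST unfolding fip_def by (meson Un_least bot_unique finite_UnI)
qed

text \<open>A family that is maximal with the finite intersection property is an ultrafilter.\<close>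

lemma fip_ultrafilter:
  fixes H :: "'a::{boolean_algebra, complete_lattice} set"
  assumes "fip H"
  obtains U where "ba_ultrafilter U" "H \<subseteq> U"
proof -
  let ?A = "{K. fip K \<and> H \<subseteq> K}"
  have "\<exists>M\<in>?A. \<forall>X\<in>?A. M \<subseteq> X \<longrightarrow> X = M"
  proof (rule subset_Zorn_nonempty)
    show "?A \<noteq> {}"
      using assms by auto
    fix C assume C: "C \<noteq> {}" "subset.chain ?A C"
    have "fip (\<Union>C)"
      unfolding fip_def
    proof (intro allI impI)
      fix S assume "finite S \<and> S \<subseteq> \<Union>C"
      then obtain K where "K \<in> C" "S \<subseteq> K"
        using finite_subset_Union_chain[of S C ?A] C by blast
      then show "Inf S \<noteq> bot"
        using C \<open>finite S \<and> S \<subseteq> \<Union>C\<close> by (auto simp: subset.chain_def fip_def)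
    qed
    moreover have "H \<subseteq> \<Union>C"
      using C by (auto simp: subset.chain_def) blast
    ultimately show "\<Union>C \<in> ?A"
      by simp
  qed
  then obtain M where M: "fip M" "H \<subseteq> M" and max: "\<And>X. fip X \<Longrightarrow> M \<subseteq> X \<Longrightarrow> X = M"
    by (smt (verit) mem_Collect_eq order_trans)
  have dec: "x \<in> M \<or> - x \<in> M" for x
    using fip_extend[OF M(1), of x] max by (metis insertI1 subset_insertI)
  have up: "y \<in> M" if "finite S" "S \<subseteq> M" "Inf S \<le> y" for S y
  proof (rule ccontr)
    assume "y \<notin> M"
    then have "insert (- y) S \<subseteq> M"
      using dec that by blast
    then have "Inf (insert (- y) S) \<noteq> bot"
      using M(1) that unfolding fip_def by blast
    then show False
      using that by (simp add: inf.commute[of "- y"] inf_shunt)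
  qed
  have "ba_filter M"
    unfolding ba_filter_def
  proof (intro conjI ballI allI impI)
    show "top \<in> M"
      using up[of "{}"] by simp
    show "bot \<notin> M"
    proof
      assume "bot \<in> M"
      then have "finite {bot} \<and> {bot} \<subseteq> M"
        by simp
      then have "Inf {bot} \<noteq> (bot :: 'a)"
        using M(1) unfolding fip_def by blast
      then show False
        by simp
    qed
    show "inf x y \<in> M" if "x \<in> M" "y \<in> M" for x y
      using up[of "{x, y}" "inf x y"] that by simp
    show "y \<in> M" if "x \<in> M" "x \<le> y" for x y
      using up[of "{x}" y] that by simp
  qed
  then show ?thesis
    using that M(2) dec unfolding ba_ultrafilter_iff by blast
qed

lemma ba_filter_Inf:
  fixes F :: "'a::{boolean_algebra, complete_lattice} set"
  assumes "ba_filter F" "finite S" "S \<subseteq> F"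
  shows "Inf S \<in> F"
  using assms(2,3)
proof (induction S)
  case empty
  then show ?case
    using assms(1) by (simp add: ba_filter_def)
next
  case (insert x S)
  then show ?case
    using assms(1) by (simp add: ba_filter_def)
qed

lemma ba_filter_fip: "ba_filter F \<Longrightarrow> fip F"
  unfolding fip_def by (metis ba_filter_Inf ba_filter_def)

text \<open>Requirements indexed by at most $\mathfrak{c}$ many \<open>i\<close> can be met simultaneously if each of them can
  be met above every family of size less than $\mathfrak{c}$: well-order the indices in the order type
  of their cardinality, so that fewer than $\mathfrak{c}$ many elements have been added before any given
  stage.\<close>

lemma fip_transfinite:
  fixes G :: "'a::{boolean_algebra, complete_lattice} set" and R :: "'i \<Rightarrow> 'a \<Rightarrow> bool"
  assumes G: "fip G" "|G| <o continuum" and I: "|UNIV :: 'i set| \<le>o continuum"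
    and step: "\<And>i H. fip H \<Longrightarrow> |H| <o continuum \<Longrightarrow> \<exists>x. R i x \<and> fip (insert x H)"
  obtains x where "\<And>i. R i (x i)" "fip (G \<union> range x)"
proof -
  define r where "r = |UNIV :: 'i set|"
  have wo: "Well_order r"
    unfolding r_def by (rule card_of_Well_order)
  have fld: "Field r = UNIV"
    by (simp add: r_def Field_card_of)
  define s where "s = r - Id"
  have wf: "wf s" and tr: "trans s" and tot: "\<And>i j. i = j \<or> (i, j) \<in> s \<or> (j, i) \<in> s"
    using wo fld by (auto simp: s_def well_order_on_def linear_order_on_def total_on_def
        partial_order_on_def preorder_on_def intro: trans_diff_Id)
  define below where "below i = {j. (j, i) \<in> s}" for i
  \<comment> \<open>Unions of stages inherit the property, since a finite subset lies in a single stage: that of its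
    largest index.\<close>
  have union: "fip (G \<union> x ` J)" if J: "\<And>j. j \<in> J \<Longrightarrow> fip (insert (x j) (G \<union> x ` below j))" for x J
    unfolding fip_def
  proof (intro allI impI, elim conjE)
    fix S assume S: "finite S" "S \<subseteq> G \<union> x ` J"
    then obtain K where K: "finite K" "K \<subseteq> J" "S - G \<subseteq> x ` K"
      by (metis Diff_subset_conv finite_Diff finite_subset_image order_refl)
    show "Inf S \<noteq> bot"
    proof (cases "K = {}")
      case True
      then show ?thesis
        using K S G by (auto simp: fip_def)
    next
      case False
      with K(1) have "\<exists>m\<in>K. \<forall>k\<in>K. k = m \<or> (k, m) \<in> s"
      proof (induction K rule: finite_ne_induct)
        case (insert a K)
        then show ?case
          using tot tr by (metis insert_iff transD)
      qed simp
      then obtain m where m: "m \<in> K" "K \<subseteq> insert m (below m)"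
        by (auto simp: below_def)
      then have "S \<subseteq> insert (x m) (G \<union> x ` below m)"
        using K by blast
      then show ?thesis
        using J[of m] m K S by (auto simp: fip_def)
    qed
  qed
  have small: "|G \<union> x ` below i| <o continuum" for x and i
  proof -
    have "below i = underS r i"
      by (auto simp: below_def underS_def s_def)
    then have "|below i| <o r"
      using card_of_underS[of r i] fld by (simp add: r_def card_of_Card_order)
    then have "|below i| <o continuum"
      using I ordLess_ordLeq_trans unfolding r_def by blast
    then show ?thesis
      by (intro Un_less_continuum G image_less_continuum)
  qed
  have "\<exists>x. \<forall>i. R i (x i) \<and> fip (insert (x i) (G \<union> x ` below i))"
  proof (rule dependent_wf_choice[OF wf])
    fix f g :: "'i \<Rightarrow> 'a" and i y
    assume "\<And>j. (j, i) \<in> s \<Longrightarrow> f j = g j"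
    then have "f ` below i = g ` below i"
      by (intro image_cong) (auto simp: below_def)
    then show "(R i y \<and> fip (insert y (G \<union> f ` below i))) = (R i y \<and> fip (insert y (G \<union> g ` below i)))"
      by simp
  next
    fix i and f :: "'i \<Rightarrow> 'a"
    assume "\<And>j. (j, i) \<in> s \<Longrightarrow> R j (f j) \<and> fip (insert (f j) (G \<union> f ` below j))"
    then have "fip (G \<union> f ` below i)"
      by (intro union) (auto simp: below_def)
    then show "\<exists>y. R i y \<and> fip (insert y (G \<union> f ` below i))"
      using step small by blast
  qed
  then obtain x where "\<And>i. R i (x i)" "\<And>i. fip (insert (x i) (G \<union> x ` below i))"
    by blast
  then show ?thesis
    using that union[of UNIV x] by blast
qed

section \<open>Ultrafilters and partitions\<close>

text \<open>Call an element big if infinitely many elements lie below it.  If a big element is split into two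
  parts, one of them is big, so there is a strictly decreasing sequence of big elements.  The
  successive differences form an infinite antichain, and the complement of their join completes it to
  a partition.\<close>

lemma infinite_partition_exists:
  assumes "infinite (UNIV :: 'a set)" "ccc TYPE('a)"
  obtains p :: "nat \<Rightarrow> 'a::{boolean_algebra, complete_lattice}" where "inj p" "ba_partition (range p)"
proof -
  define big where "big x \<longleftrightarrow> infinite {y. y \<le> x}" for x :: 'a
  have smaller: "\<exists>y. big y \<and> y < x" if "big x" for x
  proof -
    have "\<not> {y. y \<le> x} \<subseteq> {bot, x}"
      using that unfolding big_def by (meson finite.emptyI finite.insertI finite_subset)
    then obtain y where y: "y \<le> x" "y \<noteq> bot" "y \<noteq> x"
      by blast
    define z where "z = inf x (- y)"
    have "sup y z = x"
      using y by (simp add: z_def sup_inf_distrib1 sup_absorb2)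
    have "inf w x = sup (inf w y) (inf w z)" for w
      unfolding \<open>sup y z = x\<close>[symmetric] by (rule inf_sup_distrib1)
    then have "w = sup (inf w y) (inf w z)" if "w \<le> x" for w
      using that by (metis inf.absorb1)
    \<comment> \<open>An element below \<open>x\<close> is determined by its parts below \<open>y\<close> and \<open>z\<close>.\<close>
    then have "inj_on (\<lambda>w. (inf w y, inf w z)) {w. w \<le> x}"
      by (intro inj_on_inverseI[where g = "\<lambda>(a, b). sup a b"]) simp
    moreover have "(\<lambda>w. (inf w y, inf w z)) ` {w. w \<le> x} \<subseteq> {w. w \<le> y} \<times> {w. w \<le> z}"
      by auto
    ultimately have "infinite ({w. w \<le> y} \<times> {w. w \<le> z})"
      using that inj_on_finite unfolding big_def by blast
    then have "big y \<or> big z"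
      unfolding big_def by blast
    moreover have "inf z y = bot"
      by (simp add: z_def inf.assoc)
    then have "z \<noteq> x"
      using y by (metis inf.absorb2)
    then have "z < x"
      by (simp add: z_def order.not_eq_order_implies_strict)
    ultimately show ?thesis
      using y by (metis order.not_eq_order_implies_strict)
  qed
  have "big top"
    using assms(1) by (simp add: big_def)
  then obtain f where f: "\<And>n. big (f n)" "\<And>n. f (Suc n) < f n"
    using dependent_nat_choice[of "\<lambda>_. big" "\<lambda>_ x y. y < x"] smaller by metis
  define d where "d n = inf (f n) (- f (Suc n))" for n :: nat
  have d: "d n \<noteq> bot" for n
    using f(2)[of n] unfolding d_def inf_shunt by (simp add: leD)
  have disj: "inf (d m) (d n) = bot" if "m < n" for m n
  proof -
    have "f n \<le> f (Suc m)"
      using that f(2) lift_Suc_antimono_le[of f "Suc m" n] by (simp add: order.strict_implies_order)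
    then have "inf (d m) (d n) \<le> inf (- f (Suc m)) (f (Suc m))"
      unfolding d_def by (intro inf_mono) (auto intro: le_infI1)
    then show ?thesis
      by (simp add: bot_unique)
  qed
  then have disj: "inf (d m) (d n) = bot" if "m \<noteq> n" for m n
    using that by (metis inf.commute nat_neq_iff)
  then have "inj d"
    using d by (metis inf.idem injI)
  define P where "P = range d"
  define Q where "Q = insert (- Sup P) P - {bot}"
  have "infinite P"
    using \<open>inj d\<close> by (simp add: P_def range_inj_infinite)
  then have "infinite Q"
    by (simp add: Q_def)
  moreover have "ba_partition Q"
    unfolding ba_partition_def
  proof (intro conjI allI impI)
    have "inf a (- Sup P) = bot" if "a \<in> P" for a
      using that by (simp add: inf_shunt Sup_upper)
    moreover have "inf a b = bot" if "a \<in> P" "b \<in> P" "a \<noteq> b" for a b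
      using that by (auto simp: P_def intro!: disj)
    ultimately have "inf x y = bot" if "x \<in> Q" "y \<in> Q" "x \<noteq> y" for x y
      using that by (auto simp: Q_def inf.commute)
    then show "antichain Q"
      by (auto simp: antichain_def pairwise_def Q_def)
    fix R assume R: "antichain R \<and> Q \<subseteq> R"
    have "r \<in> Q" if r: "r \<in> R" for r
    proof (rule ccontr)
      assume "r \<notin> Q"
      then have q: "inf q r = bot" if "q \<in> Q" for q
        using that r R by (auto simp: antichain_def pairwise_def)
      then have "inf (Sup P) r = bot"
        unfolding inf_Sup_eq_bot_iff using d by (auto simp: Q_def P_def)
      moreover have "inf (- Sup P) r = bot"
        using q by (cases "- Sup P = bot") (auto simp: Q_def)
      ultimately have "r \<le> Sup P" "r \<le> - Sup P"
        unfolding inf.commute[of _ r] inf_shunt by simp_all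
      then have "r = bot"
        by (metis bot_unique compl_inf_bot inf_greatest)
      then show False
        using r R by (auto simp: antichain_def)
    qed
    then show "R = Q"
      using R by blast
  qed
  ultimately show ?thesis
    using infinite_partition_enumerable[OF assms(2)] that by metis
qed

lemma partition_disjoint:
  assumes "inj p" "ba_partition (range p)" "k \<noteq> l"
  shows "inf (p k) (p l) = bot"
  using assms by (auto simp: ba_partition_def antichain_def pairwise_def inj_eq)

lemma partition_nonzero:
  assumes "ba_partition (range p)"
  shows "p k \<noteq> bot"
  using assms by (metis antichain_def ba_partition_def rangeI)

lemma partition_meets:
  assumes "ba_partition (range p)" "x \<noteq> bot"
  obtains k where "inf (p k) x \<noteq> bot"
proof (rule ccontr)
  assume "\<not> thesis"
  with that have *: "inf (p k) x = bot" for k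
    by blast
  then have "antichain (insert x (range p))"
    using assms by (auto simp: ba_partition_def antichain_def pairwise_insert inf.commute)
  then have "x \<in> range p"
    using assms(1) unfolding ba_partition_def by blast
  with * have "inf x x = bot"
    by (metis imageE)
  with assms show False
    by simp
qed

text \<open>The map \<open>A \<mapsto> Sup (p ` A)\<close> embeds the power set of $\<omega>$ into the algebra as a Boolean subalgebra,
  and ultrafilters pull back along such embeddings.\<close>

lemma partition_ultrafilter:
  fixes U :: "'a::{boolean_algebra, complete_lattice} set"
  assumes U: "ba_ultrafilter U" and p: "inj p" "ba_partition (range p)"
  shows "ba_ultrafilter {A. Sup (p ` A) \<in> U}"
proof -
  have F: "ba_filter U" and dec: "\<And>x. x \<in> U \<or> - x \<in> U"
    using U by (auto simp: ba_ultrafilter_iff)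
  have top: "Sup (range p) = top"
  proof (rule ccontr)
    assume "Sup (range p) \<noteq> top"
    then have "- Sup (range p) \<noteq> bot"
      by (metis compl_bot_eq double_compl)
    then obtain k where "inf (p k) (- Sup (range p)) \<noteq> bot"
      using partition_meets[OF p(2)] by blast
    then show False
      by (simp add: inf_shunt Sup_upper)
  qed
  have compl: "- Sup (p ` A) \<le> Sup (p ` (- A))" for A
  proof -
    have "sup (Sup (p ` A)) (Sup (p ` (- A))) = top"
      using top by (metis Compl_partition Sup_union_distrib image_Un)
    then show ?thesis
      by (metis sup_commute sup_shunt)
  qed
  have outside: "inf (p k) (Sup (p ` B)) = bot" if "k \<notin> B" for k B
    unfolding inf.commute[of "p k"] inf_Sup_eq_bot_iff
    using that partition_disjoint[OF p] by (metis imageE)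
  have meet: "inf (Sup (p ` A)) (Sup (p ` B)) \<le> Sup (p ` (A \<inter> B))" for A B
  proof -
    have "inf (Sup (p ` A)) (inf (Sup (p ` B)) (- Sup (p ` (A \<inter> B)))) = bot"
      unfolding inf_Sup_eq_bot_iff
    proof
      fix a assume "a \<in> p ` A"
      then obtain k where k: "a = p k" "k \<in> A"
        by blast
      show "inf a (inf (Sup (p ` B)) (- Sup (p ` (A \<inter> B)))) = bot"
      proof (cases "k \<in> B")
        case True
        then have "a \<le> Sup (p ` (A \<inter> B))"
          using k by (intro Sup_upper) auto
        then show ?thesis
          by (metis inf.left_commute inf_bot_right inf_shunt double_compl)
      next
        case False
        then show ?thesis
          using outside[of k B] k by (metis inf.assoc inf_bot_left)
      qed
    qed
    then show ?thesis
      by (simp add: inf.assoc[symmetric] inf_shunt)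
  qed
  have "ba_filter {A. Sup (p ` A) \<in> U}"
    unfolding ba_filter_def
  proof (intro conjI ballI allI impI)
    show "top \<in> {A. Sup (p ` A) \<in> U}" "bot \<notin> {A. Sup (p ` A) \<in> U}"
      using F top by (auto simp: ba_filter_def)
    show "inf A B \<in> {A. Sup (p ` A) \<in> U}"
      if "A \<in> {A. Sup (p ` A) \<in> U}" "B \<in> {A. Sup (p ` A) \<in> U}" for A B
      using that F meet[of A B] unfolding ba_filter_def by simp blast
    show "B \<in> {A. Sup (p ` A) \<in> U}" if "A \<in> {A. Sup (p ` A) \<in> U}" "A \<le> B" for A B
      using that F Sup_subset_mono[OF image_mono[OF that(2)], of p] unfolding ba_filter_def by blast
  qed
  moreover have "A \<in> {A. Sup (p ` A) \<in> U} \<or> - A \<in> {A. Sup (p ` A) \<in> U}" for A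
    using dec[of "Sup (p ` A)"] compl[of A] F unfolding ba_filter_def by blast
  ultimately show ?thesis
    by (simp add: ba_ultrafilter_iff)
qed

text \<open>A partition of $\<omega>$ is the partition into fibres of the function that maps \<open>n\<close> to the least element
  of its block.\<close>

lemma selective_ultrafilter_iff:
  "selective_ultrafilter V \<longleftrightarrow> ba_ultrafilter V \<and>
    (\<forall>q :: nat \<Rightarrow> nat. (\<exists>c. q -` {c} \<in> V) \<or> (\<exists>X\<in>V. inj_on q X))"
proof (intro iffI conjI allI)
  assume V: "selective_ultrafilter V"
  then show "ba_ultrafilter V"
    by (simp add: selective_ultrafilter_def)
  fix q :: "nat \<Rightarrow> nat"
  define \<Q> where "\<Q> = range (\<lambda>n. q -` {q n})"
  have "partition_on UNIV \<Q>"
    by (intro partition_onI) (auto simp: \<Q>_def disjnt_def)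
  then have "(\<exists>Q\<in>\<Q>. Q \<in> V) \<or> (\<exists>X\<in>V. \<forall>Q\<in>\<Q>. \<exists>\<^sub>\<le>\<^sub>1 n. n \<in> X \<inter> Q)"
    using V by (simp add: selective_ultrafilter_def)
  moreover have "inj_on q X" if "\<forall>Q\<in>\<Q>. \<exists>\<^sub>\<le>\<^sub>1 n. n \<in> X \<inter> Q" for X
    using that by (intro inj_onI) (auto simp: \<Q>_def Uniq_def)
  ultimately show "(\<exists>c. q -` {c} \<in> V) \<or> (\<exists>X\<in>V. inj_on q X)"
    unfolding \<Q>_def by blast
next
  assume V: "ba_ultrafilter V \<and> (\<forall>q :: nat \<Rightarrow> nat. (\<exists>c. q -` {c} \<in> V) \<or> (\<exists>X\<in>V. inj_on q X))"
  show "selective_ultrafilter V"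
    unfolding selective_ultrafilter_def
  proof (intro conjI allI impI)
    show "ba_ultrafilter V"
      using V by blast
    fix \<Q> :: "nat set set" assume \<Q>: "partition_on UNIV \<Q>"
    define q where "q n = (LEAST m. \<exists>Q\<in>\<Q>. n \<in> Q \<and> m \<in> Q)" for n
    have "\<exists>Q\<in>\<Q>. n \<in> Q \<and> q n \<in> Q" for n
    proof -
      have "n \<in> \<Union>\<Q>"
        using \<Q> by (simp add: partition_on_def)
      then have "\<exists>m. \<exists>Q\<in>\<Q>. n \<in> Q \<and> m \<in> Q"
        by blast
      then show ?thesis
        unfolding q_def by (rule LeastI_ex)
    qed
    have unique: "Q = Q'" if "Q \<in> \<Q>" "Q' \<in> \<Q>" "n \<in> Q" "n \<in> Q'" for Q Q' n
      using \<Q> that by (auto simp: partition_on_def disjoint_def)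
    have q_in: "q n \<in> Q" if "Q \<in> \<Q>" "n \<in> Q" for n Q
      using \<open>\<exists>Q\<in>\<Q>. n \<in> Q \<and> q n \<in> Q\<close> unique that by blast
    have q_eq: "q n = q m" if "Q \<in> \<Q>" "n \<in> Q" "m \<in> Q" for n m Q
      unfolding q_def using that unique by (metis (no_types, lifting))
    consider c where "q -` {c} \<in> V" | X where "X \<in> V" "inj_on q X"
      using V by blast
    then show "(\<exists>Q\<in>\<Q>. Q \<in> V) \<or> (\<exists>X\<in>V. \<forall>Q\<in>\<Q>. \<exists>\<^sub>\<le>\<^sub>1 n. n \<in> X \<inter> Q)"
    proof cases
      case (1 c)
      obtain Q where Q: "Q \<in> \<Q>" "c \<in> Q"
        using \<Q> by (auto simp: partition_on_def)
      have "q -` {c} \<subseteq> Q"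
        using \<open>\<And>n. \<exists>Q\<in>\<Q>. n \<in> Q \<and> q n \<in> Q\<close> Q unique by blast
      then have "Q \<in> V"
        using 1 V by (auto simp: ba_ultrafilter_def ba_filter_def)
      then show ?thesis
        using Q by blast
    next
      case 2
      then have "\<exists>\<^sub>\<le>\<^sub>1 n. n \<in> X \<inter> Q" if "Q \<in> \<Q>" for Q
        using that q_eq by (auto simp: Uniq_def inj_on_def)
      then show ?thesis
        using 2 by blast
    qed
  qed
qed

section \<open>Baire space\<close>

definition cylinder :: "nat list \<Rightarrow> (nat \<Rightarrow> nat) set"
  where "cylinder s = {f. \<forall>i<length s. f i = s ! i}"

lemma open_cylinder: "open (cylinder s)"
proof -
  have "open (\<Inter>i\<in>{..<length s}. (\<lambda>f :: nat \<Rightarrow> nat. f i) -` {s ! i})"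
    by (intro open_INT ballI open_vimage continuous_on_product_coordinates) (auto simp: open_discrete)
  moreover have "(\<Inter>i\<in>{..<length s}. (\<lambda>f. f i) -` {s ! i}) = cylinder s"
    by (auto simp: cylinder_def)
  ultimately show ?thesis
    by simp
qed

lemma cylinder_nonempty: "cylinder s \<noteq> {}"
proof -
  have "(\<lambda>i. s ! i) \<in> cylinder s"
    by (simp add: cylinder_def)
  then show ?thesis
    by blast
qed

lemma cylinder_append: "cylinder (s @ u) \<subseteq> cylinder s"
  by (auto simp: cylinder_def nth_append)

lemma open_contains_cylinder:
  assumes "open W" "f \<in> W"
  obtains n where "\<And>m. n \<le> m \<Longrightarrow> cylinder (map f [0..<m]) \<subseteq> W"
proof -
  obtain X where X: "f \<in> (\<Pi>\<^sub>E i\<in>UNIV. X i)" "finite {i. X i \<noteq> UNIV}" "(\<Pi>\<^sub>E i\<in>UNIV. X i) \<subseteq> W"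
    using product_topology_open_contains_basis[of "\<lambda>_. euclidean" UNIV W f] assms
    by (auto simp: open_fun_def)
  obtain n where n: "\<And>i. X i \<noteq> UNIV \<Longrightarrow> i < n"
    using X(2) by (auto simp: finite_nat_set_iff_bounded)
  have "cylinder (map f [0..<m]) \<subseteq> (\<Pi>\<^sub>E i\<in>UNIV. X i)" if "n \<le> m" for m
  proof
    fix g assume g: "g \<in> cylinder (map f [0..<m])"
    have "g i \<in> X i" for i
    proof (cases "i < m")
      case True
      then show ?thesis
        using g X(1) by (auto simp: cylinder_def PiE_iff)
    next
      case False
      then have "X i = UNIV"
        using n that by (meson order_less_le_trans)
      then show ?thesis
        by simp
    qed
    then show "g \<in> (\<Pi>\<^sub>E i\<in>UNIV. X i)"
      by auto
  qed
  then show ?thesis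
    using that X(3) by blast
qed

text \<open>This turns category into combinatorics of finite sequences: any finite attempt can be continued so
  as to leave a nowhere dense set for good.\<close>

lemma nowhere_dense_iff_cylinder:
  "nowhere_dense N \<longleftrightarrow> (\<forall>s. \<exists>u. cylinder (s @ u) \<inter> N = {})"
proof (intro iffI allI)
  fix s assume N: "nowhere_dense N"
  have "\<not> cylinder s \<subseteq> closure N"
    using N cylinder_nonempty[of s] interior_maximal[OF _ open_cylinder]
    by (auto simp: nowhere_dense_def)
  then obtain f where f: "f \<in> cylinder s \<inter> - closure N"
    by blast
  moreover have "open (cylinder s \<inter> - closure N)"
    by (intro open_Int open_cylinder) (simp add: open_closed)
  ultimately obtain n where n: "\<And>m. n \<le> m \<Longrightarrow> cylinder (map f [0..<m]) \<subseteq> cylinder s \<inter> - closure N"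
    using open_contains_cylinder by meson
  define m where "m = max n (length s)"
  have "map f [0..<m] = map f [0..<length s] @ map f [length s..<m]"
    using upt_add_eq_append[of 0 "length s" "m - length s"] by (simp add: m_def)
  also have "map f [0..<length s] = s"
    using f by (auto simp: cylinder_def intro: nth_equalityI)
  finally have "cylinder (s @ map f [length s..<m]) \<subseteq> - closure N"
    using n[of m] by (simp add: m_def)
  then show "\<exists>u. cylinder (s @ u) \<inter> N = {}"
    using closure_subset[of N] by blast
next
  assume N: "\<forall>s. \<exists>u. cylinder (s @ u) \<inter> N = {}"
  show "nowhere_dense N"
    unfolding nowhere_dense_def
  proof (rule ccontr)
    assume "interior (closure N) \<noteq> {}"
    then obtain f n where "cylinder (map f [0..<n]) \<subseteq> interior (closure N)"
      using open_contains_cylinder[OF open_interior] by (metis equals0I order_refl)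
    moreover obtain u where "cylinder (map f [0..<n] @ u) \<inter> N = {}"
      using N by blast
    then have "cylinder (map f [0..<n] @ u) \<inter> closure N = {}"
      using open_Int_closure_eq_empty[OF open_cylinder] by blast
    moreover have "cylinder (map f [0..<n] @ u) \<subseteq> cylinder (map f [0..<n])"
      by (rule cylinder_append)
    moreover have "interior (closure N) \<subseteq> closure N"
      by (rule interior_subset)
    ultimately show False
      using cylinder_nonempty[of "map f [0..<n] @ u"] by auto
  qed
qed

text \<open>One and the same continuation works for finitely many sets and finitely many starting sequences:
  treat the pairs one after the other, appending a new piece each time.  What has been achieved is
  not lost, because lengthening a sequence shrinks its cylinder.\<close>

lemma nowhere_dense_avoid:
  assumes "finite R" "\<And>N t. (N, t) \<in> R \<Longrightarrow> nowhere_dense N"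
  shows "\<exists>u. \<forall>(N, t)\<in>R. cylinder (t @ u) \<inter> N = {}"
  using assms
proof (induction R)
  case (insert r R)
  obtain u where u: "\<forall>(N, t)\<in>R. cylinder (t @ u) \<inter> N = {}"
    using insert by auto
  obtain N t where r: "r = (N, t)"
    by force
  have "nowhere_dense N"
    using insert.prems[of N t] r by simp
  then obtain v where v: "cylinder ((t @ u) @ v) \<inter> N = {}"
    unfolding nowhere_dense_iff_cylinder by blast
  have "cylinder (t' @ u @ v) \<inter> N' = {}" if "(N', t') \<in> R" for N' t'
    using u that cylinder_append[of "t' @ u" v] by fastforce
  then show ?case
    using v r by (intro exI[of _ "u @ v"]) auto
qed simp

lemma nowhere_dense_imp_meager: "nowhere_dense N \<Longrightarrow> meager N"
  unfolding meager_def by (intro exI[of _ "\<lambda>_. N"]) simp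

section \<open>Generic selectors\<close>

lemma small_family_not_cover:
  fixes \<D> :: "(nat \<Rightarrow> nat) set set"
  assumes "continuum =o cov_M" "|\<D>| <o continuum" "\<And>D. D \<in> \<D> \<Longrightarrow> meager D"
  obtains f where "f \<notin> \<Union>\<D>"
proof (rule ccontr)
  assume "\<not> thesis"
  with that have "\<D> \<in> meager_covers"
    using assms(3) by (auto simp: meager_covers_def)
  then have "cov_M \<le>o |\<D>|"
    using cov_M_least by metis
  then have "continuum \<le>o |\<D>|"
    using assms(1) ordIso_ordLeq_trans by blast
  then show False
    using assms(2) not_ordLess_ordLeq by blast
qed

text \<open>The single step of the recursion, and the place where $\mathfrak{c} = \operatorname{cov}(\mathcal{M})$
  is used.  If no fibre of \<open>q\<close> gives an element compatible with \<open>H\<close>, then the traces on $\<omega>$ of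
  the finite meets from \<open>H\<close> meet infinitely many fibres.  A function \<open>f\<close> picks the point \<open>f c\<close> from the
  fibre over each \<open>c\<close> for which \<open>f c\<close> lies in that fibre, which gives the selector
  \<open>{k. f (q k) = k}\<close>; it is incompatible with a given finite meet only for a nowhere dense set of
  functions \<open>f\<close>.  As fewer than $\operatorname{cov}(\mathcal{M})$ nowhere dense sets do not cover
  Baire space, some selector is compatible with all finite meets.\<close>

lemma fip_add_selector:
  fixes p :: "nat \<Rightarrow> 'a::{boolean_algebra, complete_lattice}" and q :: "nat \<Rightarrow> nat"
  assumes cov: "continuum =o cov_M" and p: "ba_partition (range p)"
    and H: "fip H" "|H| <o continuum"
  obtains X where "(\<exists>c. X \<subseteq> q -` {c}) \<or> inj_on q X" "fip (insert (Sup (p ` X)) H)"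
proof (cases "\<exists>c. fip (insert (Sup (p ` (q -` {c}))) H)")
  case True
  then show ?thesis
    using that by blast
next
  case False
  have "\<exists>S. finite S \<and> S \<subseteq> H \<and> (\<forall>k. q k = c \<longrightarrow> inf (p k) (Inf S) = bot)" for c
  proof -
    have "\<not> fip (insert (Sup (p ` (q -` {c}))) H)"
      using False by simp
    then obtain S where "finite S" "S \<subseteq> H" "\<forall>a\<in>p ` (q -` {c}). inf a (Inf S) = bot"
      unfolding fip_insert_iff inf_Sup_eq_bot_iff by blast
    then show ?thesis
      by (intro exI[of _ S]) simp
  qed
  \<comment> \<open>\<open>T c\<close> witnesses that the fibre over \<open>c\<close> is not compatible with \<open>H\<close>.\<close>
  then obtain T where T: "\<And>c. finite (T c)" "\<And>c. T c \<subseteq> H"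
      "\<And>k. inf (p k) (Inf (T (q k))) = bot"
    by metis
  define N where "N S = {f. \<forall>k. f (q k) = k \<longrightarrow> inf (p k) (Inf S) = bot}" for S
  have "nowhere_dense (N S)" if S: "finite S" "S \<subseteq> H" for S
    unfolding nowhere_dense_iff_cylinder
  proof
    fix s :: "nat list"
    \<comment> \<open>A point met by the enlarged meet lies in a fibre whose index is beyond the domain of \<open>s\<close>, so
      \<open>s\<close> can be continued to select it.\<close>
    define S' where "S' = S \<union> (\<Union>c<length s. T c)"
    have "finite S'" "S' \<subseteq> H"
      using S T(1,2) by (auto simp: S'_def)
    then have "Inf S' \<noteq> bot"
      using H(1) by (simp add: fip_def)
    then obtain k where k: "inf (p k) (Inf S') \<noteq> bot"
      using partition_meets[OF p] by blast
    have meets: "inf (p k) (Inf R) \<noteq> bot" if "R \<subseteq> S'" for R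
      using k inf_mono[OF order_refl Inf_superset_mono[OF that]] by (metis bot_unique)
    have "length s \<le> q k"
    proof (rule ccontr)
      assume "\<not> length s \<le> q k"
      then have "T (q k) \<subseteq> S'"
        by (auto simp: S'_def)
      then show False
        using meets T(3) by blast
    qed
    define u where "u = replicate (q k - length s) 0 @ [k]"
    have "f (q k) = k" if "f \<in> cylinder (s @ u)" for f
      using that \<open>length s \<le> q k\<close> by (auto simp: cylinder_def u_def nth_append dest: spec[of _ "q k"])
    moreover have "inf (p k) (Inf S) \<noteq> bot"
      by (rule meets) (simp add: S'_def)
    ultimately show "\<exists>u. cylinder (s @ u) \<inter> N S = {}"
      by (intro exI[of _ u]) (auto simp: N_def)
  qed
  then have "meager D" if "D \<in> N ` Fpow H" for D
    using that by (auto simp: Fpow_def intro: nowhere_dense_imp_meager)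
  moreover have "|N ` Fpow H| <o continuum"
    by (intro image_less_continuum Fpow_less_continuum H)
  ultimately obtain f where f: "f \<notin> \<Union>(N ` Fpow H)"
    using small_family_not_cover[OF cov] by meson
  define X where "X = {k. f (q k) = k}"
  have "inj_on q X"
    by (rule inj_on_inverseI[where g = f]) (simp add: X_def)
  moreover have "fip (insert (Sup (p ` X)) H)"
    unfolding fip_insert_iff inf_Sup_eq_bot_iff
  proof (intro allI impI)
    fix S assume "finite S \<and> S \<subseteq> H"
    then have "f \<notin> N S"
      using f by (auto simp: Fpow_def)
    then obtain k where "f (q k) = k" "inf (p k) (Inf S) \<noteq> bot"
      by (auto simp: N_def)
    then show "\<not> (\<forall>a\<in>p ` X. inf a (Inf S) = bot)"
      by (auto simp: X_def)
  qed
  ultimately show ?thesis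
    using that by blast
qed

text \<open>The recursion runs over all pairs of an enumerated partition \<open>p\<close> of the algebra and a function \<open>q\<close>;
  the element added for such a pair makes every ultrafilter above the family selective with respect
  to \<open>p\<close> and the fibres of \<open>q\<close>.\<close>

lemma coherent_extension:
  fixes G :: "'a::{boolean_algebra, complete_lattice} set"
  assumes cov: "continuum =o cov_M" and card: "|UNIV :: 'a set| \<le>o continuum"
    and G: "fip G" "|G| <o continuum"
  obtains U where "coherent_selective_ultrafilter U" "G \<subseteq> U"
proof -
  define R :: "(nat \<Rightarrow> 'a) \<times> (nat \<Rightarrow> nat) \<Rightarrow> 'a \<Rightarrow> bool" where
    "R = (\<lambda>(p, q) x. ba_partition (range p) \<longrightarrow>
       (\<exists>X. x = Sup (p ` X) \<and> ((\<exists>c. X \<subseteq> q -` {c}) \<or> inj_on q X)))"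
  have "\<exists>x. R i x \<and> fip (insert x H)" if H: "fip H" "|H| <o continuum" for i and H :: "'a set"
  proof -
    obtain p q where i: "i = (p, q)"
      by force
    show ?thesis
    proof (cases "ba_partition (range p)")
      case True
      obtain X where "(\<exists>c. X \<subseteq> q -` {c}) \<or> inj_on q X" "fip (insert (Sup (p ` X)) H)"
        using fip_add_selector[OF cov True H] .
      then show ?thesis
        unfolding i R_def by blast
    next
      case False
      then show ?thesis
        using H(1) fip_extend unfolding i R_def by blast
    qed
  qed
  then obtain x where x: "\<And>i. R i (x i)" "fip (G \<union> range x)"
    using fip_transfinite[OF G sequences_le_continuum[OF card]] by metis
  obtain U where U: "ba_ultrafilter U" "G \<union> range x \<subseteq> U"
    using fip_ultrafilter[OF x(2)] .
  have "selective_ultrafilter {A. Sup (p ` A) \<in> U}" if p: "inj p" "ba_partition (range p)" for p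
  proof -
    let ?V = "{A. Sup (p ` A) \<in> U}"
    have V: "ba_ultrafilter ?V"
      using partition_ultrafilter[OF U(1) p] .
    have "(\<exists>c. q -` {c} \<in> ?V) \<or> (\<exists>X\<in>?V. inj_on q X)" for q :: "nat \<Rightarrow> nat"
    proof -
      obtain X where X: "x (p, q) = Sup (p ` X)" "(\<exists>c. X \<subseteq> q -` {c}) \<or> inj_on q X"
        using x(1)[of "(p, q)"] p(2) by (auto simp: R_def)
      have "x (p, q) \<in> U"
        using U(2) by blast
      then have "X \<in> ?V"
        unfolding X(1) by simp
      moreover have "Y \<in> ?V" if "X \<in> ?V" "X \<subseteq> Y" for Y
        using V that unfolding ba_ultrafilter_def ba_filter_def by blast
      ultimately show ?thesis
        using X(2) by blast
    qed
    then show ?thesis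
      using V unfolding selective_ultrafilter_iff by blast
  qed
  then show ?thesis
    using that U unfolding coherent_selective_ultrafilter_def by blast
qed

section \<open>A small filter base with no selective extension\<close>

text \<open>A selective ultrafilter contains sets that are arbitrarily sparse with respect to a function \<open>h\<close>
  that is unbounded on each of its members.  First \<open>h\<close> itself is made injective.  Then cut $\<omega>$ into intervals
  \<open>[k j, k (Suc j))\<close> so long that \<open>G\<close> cannot jump over a whole one, and select at most one point from
  each; keeping only intervals whose indices have the same parity leaves a full interval between any
  two selected points.\<close>

lemma selective_sparse:
  fixes h G :: "nat \<Rightarrow> nat"
  assumes V: "selective_ultrafilter V" and h: "\<And>k. {x. k \<le> h x} \<in> V"
  obtains X where "X \<in> V" "inj_on h X"
    "\<And>x y. x \<in> X \<Longrightarrow> y \<in> X \<Longrightarrow> h x < h y \<Longrightarrow> G x < h y"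
proof -
  have V': "ba_ultrafilter V" and sel: "\<And>q :: nat \<Rightarrow> nat. (\<exists>c. q -` {c} \<in> V) \<or> (\<exists>X\<in>V. inj_on q X)"
    using V by (auto simp: selective_ultrafilter_iff)
  have int: "A \<inter> B \<in> V" if "A \<in> V" "B \<in> V" for A B
    using V' that by (auto simp: ba_ultrafilter_def ba_filter_def)
  have disj: "A \<inter> B \<noteq> {}" if "A \<in> V" "B \<in> V" for A B
    using int[OF that] V' by (auto simp: ba_ultrafilter_def ba_filter_def)
  have "h -` {c} \<notin> V" for c
    using disj[OF _ h[of "Suc c"], of "h -` {c}"] by fastforce
  then obtain X0 where X0: "X0 \<in> V" "inj_on h X0"
    using sel[of h] by blast
  define g where "g n = G (inv_into X0 h n)" for n
  define K where "K m = Suc (m + (\<Sum>i\<le>m. g i))" for m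
  define k where "k j = (K ^^ j) 0" for j
  have k_less: "k j < k (Suc j)" for j
    by (simp add: k_def K_def)
  have k_mono: "k i \<le> k j" if "i \<le> j" for i j
    using that k_less by (simp add: lift_Suc_mono_le less_imp_le)
  have k_ge: "j \<le> k j" for j
  proof (induction j)
    case (Suc j)
    then show ?case
      using k_less[of j] by simp
  qed simp
  have g_less: "g n < k (Suc j)" if "n \<le> k j" for n j
    using that member_le_sum[of n "{..k j}" g] by (simp add: k_def K_def)
  define l where "l x = (LEAST j. h x < k (Suc j))" for x
  have l1: "h x < k (Suc (l x))" for x
    unfolding l_def by (rule LeastI[of _ "h x"]) (metis Suc_le_eq k_ge)
  have l2: "k j \<le> h x" if "j \<le> l x" for j x
  proof (cases j)
    case (Suc i)
    then show ?thesis
      using that not_less_Least[of i "\<lambda>j. h x < k (Suc j)"] by (simp add: l_def)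
  qed (simp add: k_def)
  have "l -` {c} \<notin> V" for c
  proof
    assume "l -` {c} \<in> V"
    then obtain x where "l x = c" "k (Suc c) \<le> h x"
      using disj[OF _ h[of "k (Suc c)"], of "l -` {c}"] by auto
    then show False
      using l1[of x] by simp
  qed
  then obtain X1 where X1: "X1 \<in> V" "inj_on l X1"
    using sel[of l] by blast
  obtain P where P: "P \<in> V" "\<And>x y. x \<in> P \<Longrightarrow> y \<in> P \<Longrightarrow> even (l x) = even (l y)"
  proof (cases "{x. even (l x)} \<in> V")
    case True
    then show ?thesis
      using that by blast
  next
    case False
    then have "- {x. even (l x)} \<in> V"
      using V' by (auto simp: ba_ultrafilter_iff)
    then show ?thesis
      using that by blast
  qed
  show ?thesis
  proof
    show "X0 \<inter> X1 \<inter> P \<in> V"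
      using X0 X1 P int by blast
    show "inj_on h (X0 \<inter> X1 \<inter> P)"
      using X0(2) by (auto intro: inj_on_subset)
    fix x y assume xy: "x \<in> X0 \<inter> X1 \<inter> P" "y \<in> X0 \<inter> X1 \<inter> P" "h x < h y"
    have "l x \<le> l y"
      using l1[of y] l2[of "Suc (l y)" x] xy(3) by (meson leD less_trans not_less_eq_eq order_le_less_trans)
    moreover have "l x \<noteq> l y"
      using xy X1(2) by (auto simp: inj_on_def)
    ultimately have "Suc (Suc (l x)) \<le> l y"
      using P(2)[of x y] xy by (metis IntD2 Suc_leI even_Suc le_neq_implies_less)
    then have "k (Suc (Suc (l x))) \<le> h y"
      by (rule l2)
    moreover have "g (h x) < k (Suc (Suc (l x)))"
      using g_less l1[of x] by simp
    moreover have "g (h x) = G x"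
      using xy X0 by (simp add: g_def)
    ultimately show "G x < h y"
      by simp
  qed
qed

text \<open>A size of sequences that is additive under concatenation and for which only finitely many
  sequences lie below any given bound.\<close>

definition weight :: "nat list \<Rightarrow> nat"
  where "weight t = length t + sum_list t"

lemma finite_weight_le: "finite {t. weight t \<le> n}"
proof -
  have "{t. weight t \<le> n} \<subseteq> {t. set t \<subseteq> {..n} \<and> length t \<le> n}"
    using member_le_sum_list by (force simp: weight_def)
  then show ?thesis
    by (rule finite_subset) (simp add: finite_lists_length_le)
qed

lemma concat_upt_prefix:
  assumes "i < length (concat (map u [0..<m]))" "i < length (concat (map u [0..<n]))"
  shows "concat (map u [0..<m]) ! i = concat (map u [0..<n]) ! i"
proof -
  have *: "concat (map u [0..<a]) ! i = concat (map u [0..<b]) ! i"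
    if "a \<le> b" "i < length (concat (map u [0..<a]))" for a b
  proof -
    have "concat (map u [0..<b]) = concat (map u [0..<a]) @ concat (map u [a..<b])"
      using that(1) by (metis concat_append le_add_diff_inverse map_append upt_add_eq_append zero_le)
    then show ?thesis
      using that(2) by (simp add: nth_append)
  qed
  show ?thesis
    using *[of m n] *[of n m] assms by (metis nat_le_linear)
qed

text \<open>Let \<open>\<C>\<close> be a cover of Baire space by fewer than $\mathfrak{c}$ meager sets, each of them written as
  a union of nowhere dense sets \<open>N M i\<close>.  The filter lives on the pairs of a number $n$ and a finite
  sequence $u$, coded as natural numbers, to be read as ``at stage $n$, append $u$''.  For every
  \<open>M \<in> \<C>\<close> take the set of pairs such that appending $u$ to any of the finitely many sequences of
  weight at most $n$ avoids \<open>N M 0, \<dots>, N M n\<close>; take also the sets of all pairs with first component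
  at least $k$.  Any finitely many of these sets have a common element.

  A selective ultrafilter that contains them all contains a set \<open>X\<close> with at most one pair for each
  stage, and so sparse that the instructions carried out before a stage $n$ of \<open>X\<close> have produced a
  sequence of weight at most $n$.  Carrying out all the instructions in \<open>X\<close> then produces a point
  that is outside every \<open>N M i\<close>: there are pairs in \<open>X\<close> beyond stage $i$ that belong to the set of \<open>M\<close>.
  This contradicts that \<open>\<C>\<close> is a cover.\<close>

lemma base_without_selective_extension:
  assumes C: "\<C> \<in> meager_covers" "|\<C>| <o continuum"
  obtains \<H> :: "nat set set" where "fip \<H>" "|\<H>| <o continuum"
    "\<And>V. selective_ultrafilter V \<Longrightarrow> \<not> \<H> \<subseteq> V"
proof -
  have "\<exists>N :: nat \<Rightarrow> _. (\<forall>n. nowhere_dense (N n)) \<and> M = (\<Union>n. N n)" if "M \<in> \<C>" for M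
    using that C(1) by (auto simp: meager_covers_def meager_def)
  then obtain N :: "_ \<Rightarrow> nat \<Rightarrow> _" where
    N: "\<And>M n. M \<in> \<C> \<Longrightarrow> nowhere_dense (N M n)" "\<And>M. M \<in> \<C> \<Longrightarrow> M = (\<Union>n. N M n)"
    by metis
  define stage :: "nat \<Rightarrow> nat" where "stage x = fst (from_nat x :: nat \<times> nat list)" for x
  define step :: "nat \<Rightarrow> nat list" where "step x = snd (from_nat x :: nat \<times> nat list)" for x
  define avoid where "avoid M = {x. \<forall>i\<le>stage x. \<forall>t. weight t \<le> stage x \<longrightarrow>
      cylinder (t @ step x) \<inter> N M i = {}}" for M
  define late where "late k = {x. k \<le> stage x}" for k
  define \<H> where "\<H> = avoid ` \<C> \<union> range late"
  show ?thesis
  proof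
    show "|\<H>| <o continuum"
      unfolding \<H>_def by (intro Un_less_continuum image_less_continuum C countable_less_continuum) auto
    show "fip \<H>"
      unfolding fip_def
    proof (intro allI impI, elim conjE)
      fix S assume S: "finite S" "S \<subseteq> \<H>"
      have "S - range late \<subseteq> avoid ` \<C>"
        using S(2) by (auto simp: \<H>_def)
      then obtain \<D> where D: "finite \<D>" "\<D> \<subseteq> \<C>" "S - range late = avoid ` \<D>"
        using S(1) finite_subset_image[of "S - range late" avoid \<C>] by blast
      obtain J where J: "finite J" "S \<inter> range late = late ` J"
        using S finite_subset_image[of "S \<inter> range late" late UNIV] by auto
      obtain n where n: "\<And>j. j \<in> J \<Longrightarrow> j \<le> n"
        using J(1) finite_nat_set_iff_bounded_le by auto
      define R where "R = (\<lambda>(M, i, t). (N M i, t)) ` (\<D> \<times> {..n} \<times> {t. weight t \<le> n})"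
      have "finite R"
        using D finite_weight_le by (auto simp: R_def)
      moreover have "nowhere_dense A" if "(A, t) \<in> R" for A t
        using that D N(1) by (auto simp: R_def)
      ultimately obtain u where u: "\<forall>(A, t)\<in>R. cylinder (t @ u) \<inter> A = {}"
        using nowhere_dense_avoid by meson
      define x where "x = to_nat (n, u)"
      have x: "stage x = n" "step x = u"
        by (simp_all add: x_def stage_def step_def)
      have "x \<in> avoid M" if "M \<in> \<D>" for M
        unfolding avoid_def mem_Collect_eq x
      proof (intro allI impI)
        fix i t assume "i \<le> n" "weight t \<le> n"
        then have "(N M i, t) \<in> R"
          unfolding R_def using that by (intro image_eqI[of _ _ "(M, i, t)"]) auto
        then show "cylinder (t @ u) \<inter> N M i = {}"
          using u by blast
      qed
      moreover have "x \<in> late j" if "j \<in> J" for j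
        using n that by (simp add: late_def x)
      ultimately have "x \<in> A" if "A \<in> S" for A
        using that D(3) J(2) by (metis DiffI IntI imageE)
      then show "Inf S \<noteq> bot"
        by auto
    qed
    fix V :: "nat set set" assume V: "selective_ultrafilter V"
    show "\<not> \<H> \<subseteq> V"
    proof
      assume HV: "\<H> \<subseteq> V"
      then have "{x. k \<le> stage x} \<in> V" for k
        by (auto simp: \<H>_def late_def)
      then obtain X where X: "X \<in> V" "inj_on stage X"
        "\<And>x y. x \<in> X \<Longrightarrow> y \<in> X \<Longrightarrow> stage x < stage y \<Longrightarrow> stage x + weight (step x) < stage y"
        using selective_sparse[OF V, of stage "\<lambda>x. stage x + weight (step x)"] by metis
      define u where "u n = (if n \<in> stage ` X then step (inv_into X stage n) else [])" for n
      define t where "t n = concat (map u [0..<n])" for n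
      have u: "u (stage x) = step x" if "x \<in> X" for x
        using that X(2) by (simp add: u_def)
      have t_Suc: "t (Suc n) = t n @ u n" for n
        by (simp add: t_def)
      \<comment> \<open>The sparseness of \<open>X\<close> was chosen for this: the weight after stage \<open>stage x\<close> is at most
        \<open>stage x + weight (step x)\<close>, hence below every later stage.\<close>
      have weight_t: "weight (t n) \<le> stage y" if "y \<in> X" "n \<le> stage y" for n y
        using that
      proof (induction n arbitrary: y)
        case 0
        then show ?case
          by (simp add: t_def weight_def)
      next
        case (Suc n)
        show ?case
        proof (cases "n \<in> stage ` X")
          case True
          then obtain x where x: "x \<in> X" "n = stage x"
            by blast
          have "weight (t n) \<le> n"
            using Suc.IH[of x] x by simp
          then have "weight (t (Suc n)) \<le> stage x + weight (step x)"
            using x u by (simp add: t_Suc weight_def)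
          then show ?thesis
            using X(3)[OF x(1) Suc.prems(1)] x Suc.prems(2) by simp
        next
          case False
          then show ?thesis
            using Suc by (simp add: t_Suc u_def)
        qed
      qed
      \<comment> \<open>The \<open>t n\<close> extend one another.  Beyond their union, if it is finite, the values are arbitrary.\<close>
      define f where "f i = t (SOME n. i < length (t n)) ! i" for i
      have f: "f \<in> cylinder (t n)" for n
      proof -
        have "f i = t n ! i" if "i < length (t n)" for i
          unfolding f_def using someI[of "\<lambda>n. i < length (t n)" n, OF that] that
          unfolding t_def by (rule concat_upt_prefix)
        then show ?thesis
          by (simp add: cylinder_def)
      qed
      obtain M i where M: "M \<in> \<C>" "f \<in> N M i"
        using C(1) N(2) by (auto simp: meager_covers_def) (metis UNIV_I UN_iff UnionE)
      have "avoid M \<in> V" "late i \<in> V"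
        using HV M by (auto simp: \<H>_def)
      then have "X \<inter> avoid M \<inter> late i \<in> V" "{} \<notin> V"
        using X(1) V by (auto simp: selective_ultrafilter_def ba_ultrafilter_def ba_filter_def)
      then have "X \<inter> avoid M \<inter> late i \<noteq> {}"
        by metis
      then obtain x where x: "x \<in> X" "x \<in> avoid M" "x \<in> late i"
        by blast
      then have "cylinder (t (stage x) @ step x) \<inter> N M i = {}"
        using weight_t[OF x(1)] by (auto simp: avoid_def late_def)
      then show False
        using f[of "Suc (stage x)"] M(2) u[OF x(1)] by (auto simp: t_Suc)
    qed
  qed
qed

lemma fip_filter:
  fixes K :: "'a::{boolean_algebra, complete_lattice} set"
  assumes "fip K" "|K| <o continuum"
  obtains F G where "ba_filter F" "filter_base G F" "|G| <o continuum" "K \<subseteq> F"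
proof (rule that[of "{x. \<exists>y\<in>Inf ` Fpow K. y \<le> x}" "Inf ` Fpow K"])
  show "filter_base (Inf ` Fpow K) {x. \<exists>y\<in>Inf ` Fpow K. y \<le> x}"
    by (auto simp: filter_base_def)
  show "|Inf ` Fpow K| <o continuum"
    by (intro image_less_continuum Fpow_less_continuum assms)
  show "K \<subseteq> {x. \<exists>y\<in>Inf ` Fpow K. y \<le> x}"
  proof
    fix x assume "x \<in> K"
    then have "{x} \<in> Fpow K"
      by (simp add: Fpow_def)
    then show "x \<in> {x. \<exists>y\<in>Inf ` Fpow K. y \<le> x}"
      by force
  qed
  show "ba_filter {x. \<exists>y\<in>Inf ` Fpow K. y \<le> x}"
    unfolding ba_filter_def
  proof (intro conjI ballI allI impI)
    show "top \<in> {x. \<exists>y\<in>Inf ` Fpow K. y \<le> x}"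
      using empty_in_Fpow[of K] by auto
    show "bot \<notin> {x. \<exists>y\<in>Inf ` Fpow K. y \<le> x}"
      using assms(1) by (auto simp: fip_def Fpow_def bot_unique)
    fix x y assume "x \<in> {x. \<exists>y\<in>Inf ` Fpow K. y \<le> x}" "y \<in> {x. \<exists>y\<in>Inf ` Fpow K. y \<le> x}"
    then obtain S T where ST: "S \<in> Fpow K" "T \<in> Fpow K" "Inf S \<le> x" "Inf T \<le> y"
      by blast
    then have "S \<union> T \<in> Fpow K" "Inf (S \<union> T) \<le> inf x y"
      by (auto simp: Fpow_def Inf_union_distrib intro: le_infI1 le_infI2)
    then show "inf x y \<in> {x. \<exists>y\<in>Inf ` Fpow K. y \<le> x}"
      by blast
  next
    fix x y assume "x \<in> {x. \<exists>y\<in>Inf ` Fpow K. y \<le> x}" "x \<le> y"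
    then show "y \<in> {x. \<exists>y\<in>Inf ` Fpow K. y \<le> x}"
      by (auto intro: order_trans)
  qed
qed

lemma fip_transfer_partition:
  fixes p :: "nat \<Rightarrow> 'a::{boolean_algebra, complete_lattice}"
  assumes p: "ba_partition (range p)" and H: "fip \<H>"
  shows "fip ((\<lambda>A. Sup (p ` A)) ` \<H>)"
  unfolding fip_def
proof (intro allI impI, elim conjE)
  fix S assume "finite S" "S \<subseteq> (\<lambda>A. Sup (p ` A)) ` \<H>"
  then obtain T where T: "finite T" "T \<subseteq> \<H>" "S = (\<lambda>A. Sup (p ` A)) ` T"
    by (meson finite_subset_image)
  then have "\<Inter>T \<noteq> {}"
    using H by (simp add: fip_def)
  then obtain k where "\<And>A. A \<in> T \<Longrightarrow> k \<in> A"
    by blast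
  then have "p k \<le> Inf S"
    unfolding T(3) by (auto intro!: Inf_greatest Sup_upper)
  then show "Inf S \<noteq> bot"
    using partition_nonzero[OF p, of k] by (metis bot_unique)
qed

theorem proposition3p7:
  assumes infinite: "infinite (UNIV :: 'a::{boolean_algebra, complete_lattice} set)"
    and ccc: "ccc TYPE('a)"
    and card_le: "|UNIV :: 'a set| \<le>o continuum"
  shows "(\<forall>F :: 'a set. ba_filter F \<and> (\<exists>G. filter_base G F \<and> |G| <o continuum) \<longrightarrow>
            (\<exists>U. coherent_selective_ultrafilter U \<and> F \<subseteq> U))
         \<longleftrightarrow> continuum =o cov_M"
proof
  assume cov: "continuum =o cov_M"
  show "\<forall>F :: 'a set. ba_filter F \<and> (\<exists>G. filter_base G F \<and> |G| <o continuum) \<longrightarrow>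
            (\<exists>U. coherent_selective_ultrafilter U \<and> F \<subseteq> U)"
  proof (intro allI impI, elim conjE exE)
    fix F G :: "'a set" assume F: "ba_filter F" and G: "filter_base G F" "|G| <o continuum"
    have "fip G"
      using ba_filter_fip[OF F] G(1) by (auto simp: filter_base_def intro: fip_mono)
    then obtain U where U: "coherent_selective_ultrafilter U" "G \<subseteq> U"
      using coherent_extension[OF cov card_le _ G(2)] by blast
    then have "F \<subseteq> U"
      using G(1) unfolding coherent_selective_ultrafilter_def ba_ultrafilter_def ba_filter_def
        filter_base_def by blast
    then show "\<exists>U. coherent_selective_ultrafilter U \<and> F \<subseteq> U"
      using U(1) by blast
  qed
next
  assume ext: "\<forall>F :: 'a set. ba_filter F \<and> (\<exists>G. filter_base G F \<and> |G| <o continuum) \<longrightarrow>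
            (\<exists>U. coherent_selective_ultrafilter U \<and> F \<subseteq> U)"
  show "continuum =o cov_M"
  proof (rule ccontr)
    assume "\<not> continuum =o cov_M"
    then have less: "cov_M <o continuum"
      using cov_M_le_continuum ordLeq_iff_ordLess_or_ordIso ordIso_symmetric by blast
    obtain \<C> where C: "\<C> \<in> meager_covers" "cov_M = |\<C>|"
      using cov_M_least by metis
    obtain \<H> where H: "fip \<H>" "|\<H>| <o continuum"
      "\<And>V. selective_ultrafilter V \<Longrightarrow> \<not> \<H> \<subseteq> V"
      using base_without_selective_extension[OF C(1)] less C(2) by metis
    obtain p :: "nat \<Rightarrow> 'a" where p: "inj p" "ba_partition (range p)"
      using infinite_partition_exists[OF infinite ccc] .
    obtain F G where F: "ba_filter F" "filter_base G F" "|G| <o continuum"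
      "(\<lambda>A. Sup (p ` A)) ` \<H> \<subseteq> F"
      using fip_filter[OF fip_transfer_partition[OF p(2) H(1)] image_less_continuum[OF H(2)]] .
    then obtain U where U: "coherent_selective_ultrafilter U" "F \<subseteq> U"
      using ext by blast
    then have "selective_ultrafilter {A. Sup (p ` A) \<in> U}"
      using p by (simp add: coherent_selective_ultrafilter_def)
    then show False
      using H(3) F(4) U(2) by blast
  qed
qed

end
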